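(* There exist two equivalent $C^{\infty}$ flows $\varphi$ and $\widehat{\varphi}$ on the two-dimensional sphere $\mathbb{S}^2$ such that $$EP(\varphi)=0\qquad\text{and}\qquad EP(\widehat{\varphi})=\infty .$$
   Context: A flow on a manifold $M$ is a continuous map $\phi:M\times\mathbb{R}\to M$ with $\phi(x,0)=x$ and $\phi(\phi(x,s),t)=\phi(x,s+t)$; it is $C^\infty$ if it is the flow of a $C^\infty$ vector field. Two flows $\phi,\psi$ on $M$ are equivalent if there is a homeomorphism $\pi:M\to M$ sending each orbit of $\phi$ onto an orbit of $\psi$ while preserving the time orientation, i.e. $\{\phi(x,t):t\in\mathbb{R}\}=\{\pi^{-1}\psi(\pi(x),t):t\in\mathbb{R}\}$ for all $x\in M$, with the direction of time preserved. For $t>0$ let $P_t(\phi)$ be the set of isolated periodic orbits $\mathrm{orb}(\phi,x)$ (orbits having a neighborhood containing no other periodic orbit) such that $\phi(x,s)=x$ for some $0<s\le t$. The exponential growth rate of periodic orbits is $$EP(\phi)=\limsup_{t\to+\infty}\frac1t\log \#P_t(\phi),$$ where $\#$ denotes cardinality. *)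

theory Defs
  imports "HOL-Analysis.Analysis" "HOL-Library.Liminf_Limsup"
begin

definition S2 :: "(real^3) set" where
  "S2 = sphere 0 1"

fun Ck :: "nat \<Rightarrow> ('a::real_normed_vector \<Rightarrow> 'b::real_normed_vector) \<Rightarrow> 'a set \<Rightarrow> bool" where
  "Ck 0 f U = continuous_on U f"
| "Ck (Suc k) f U = (\<exists>f'. (\<forall>x\<in>U. (f has_derivative f' x) (at x)) \<and> (\<forall>v. Ck k (\<lambda>x. f' x v) U))"

definition smooth_on :: "'a::real_normed_vector set \<Rightarrow> ('a \<Rightarrow> 'b::real_normed_vector) \<Rightarrow> bool" where
  "smooth_on U f = (\<forall>k. Ck k f U)"

definition smooth_vector_field_S2 :: "(real^3 \<Rightarrow> real^3) \<Rightarrow> bool" where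
  "smooth_vector_field_S2 V = ((\<exists>U. open U \<and> S2 \<subseteq> U \<and> smooth_on U V) \<and> (\<forall>x\<in>S2. V x \<bullet> x = 0))"

definition is_flow_S2 :: "(real^3 \<Rightarrow> real \<Rightarrow> real^3) \<Rightarrow> bool" where
  "is_flow_S2 \<phi> = ((\<forall>x\<in>S2. \<forall>t. \<phi> x t \<in> S2)
     \<and> continuous_on (S2 \<times> UNIV) (\<lambda>(x,t). \<phi> x t)
     \<and> (\<forall>x\<in>S2. \<phi> x 0 = x)
     \<and> (\<forall>x\<in>S2. \<forall>s t. \<phi> (\<phi> x s) t = \<phi> x (s + t)))"

definition smooth_flow_S2 :: "(real^3 \<Rightarrow> real \<Rightarrow> real^3) \<Rightarrow> bool" where
  "smooth_flow_S2 \<phi> = (is_flow_S2 \<phi> \<and> (\<exists>V. smooth_vector_field_S2 V \<and>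
     (\<forall>x\<in>S2. \<forall>t. ((\<lambda>s. \<phi> x s) has_vector_derivative V (\<phi> x t)) (at t))))"

definition orb :: "(real^3 \<Rightarrow> real \<Rightarrow> real^3) \<Rightarrow> real^3 \<Rightarrow> (real^3) set" where
  "orb \<phi> x = range (\<phi> x)"

definition flows_equivalent :: "(real^3 \<Rightarrow> real \<Rightarrow> real^3) \<Rightarrow> (real^3 \<Rightarrow> real \<Rightarrow> real^3) \<Rightarrow> bool" where
  "flows_equivalent \<phi> \<psi> = (\<exists>\<pi> \<pi>'. homeomorphism S2 S2 \<pi> \<pi>' \<and>
     (\<forall>x\<in>S2. orb \<phi> x = \<pi>' ` orb \<psi> (\<pi> x) \<and>
        (\<exists>\<tau>::real\<Rightarrow>real. strict_mono \<tau> \<and> \<tau> 0 = 0 \<and> (\<forall>t. \<pi> (\<phi> x t) = \<psi> (\<pi> x) (\<tau> t)))))"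

definition periodic_point :: "(real^3 \<Rightarrow> real \<Rightarrow> real^3) \<Rightarrow> real^3 \<Rightarrow> bool" where
  "periodic_point \<phi> x = (\<exists>s>0. \<phi> x s = x)"

definition periodic_orbits :: "(real^3 \<Rightarrow> real \<Rightarrow> real^3) \<Rightarrow> (real^3) set set" where
  "periodic_orbits \<phi> = {orb \<phi> x | x. x \<in> S2 \<and> periodic_point \<phi> x}"

definition isolated_orbit :: "(real^3 \<Rightarrow> real \<Rightarrow> real^3) \<Rightarrow> (real^3) set \<Rightarrow> bool" where
  "isolated_orbit \<phi> Orb = (\<exists>U. open U \<and> Orb \<subseteq> U \<and>
     (\<forall>O'\<in>periodic_orbits \<phi>. O' \<subseteq> U \<longrightarrow> O' = Orb))"

definition P :: "(real^3 \<Rightarrow> real \<Rightarrow> real^3) \<Rightarrow> real \<Rightarrow> (real^3) set set" where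
  "P \<phi> t = {orb \<phi> x | x. x \<in> S2 \<and> isolated_orbit \<phi> (orb \<phi> x) \<and> (\<exists>s. 0 < s \<and> s \<le> t \<and> \<phi> x s = x)}"

definition growth_term :: "(real^3 \<Rightarrow> real \<Rightarrow> real^3) \<Rightarrow> real \<Rightarrow> ereal" where
  "growth_term \<phi> t = (if infinite (P \<phi> t) then \<infinity>
      else if card (P \<phi> t) = 0 then -\<infinity>
      else ereal (ln (real (card (P \<phi> t))) / t))"

definition EP :: "(real^3 \<Rightarrow> real \<Rightarrow> real^3) \<Rightarrow> ereal" where
  "EP \<phi> = Limsup at_top (growth_term \<phi>)"

end

theory Submission
  imports Defs
begin

text \<open>The flow \<open>\<psi>\<close> rotates the sphere about the vertical axis with unit angular speed while drifting
  along the meridians with a speed proportional to \<open>exp (- 1/s) * sin (1/s)\<close>, where \<open>s = 1 - z\<close> is the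
  distance in height from the north pole. Its closed orbits are the circles \<open>s = 1 / (k \<pi>)\<close>. They
  are isolated, accumulate only at the north pole, and all have period \<open>2 \<pi>\<close>, so infinitely many of
  them are counted at once. The flow \<open>\<phi>\<close> is \<open>\<psi>\<close> slowed down by the factor \<open>s\<close>: it has the same
  oriented orbits, since \<open>s\<close> vanishes only at the north pole, which is fixed anyway and which no
  other orbit approaches. But now the \<open>k\<close>-th circle has period \<open>2 \<pi>\<^sup>2 k\<close>, so the number of closed
  orbits of period at most \<open>t\<close> grows linearly in \<open>t\<close>.\<close>

subsection \<open>Calculus of \<open>Ck\<close> functions\<close>

text \<open>This is what the product rule needs: in the derivative of a product the undifferentiated
  factors reappear and must be used at one order less.\<close>

lemma Ck_Suc_imp_Ck: "Ck (Suc k) f U \<Longrightarrow> Ck k f U"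
proof (induction k arbitrary: f)
  case 0
  then show ?case
    by (auto intro!: continuous_at_imp_continuous_on dest: has_derivative_continuous)
next
  case (Suc k)
  then obtain f' where "\<forall>x\<in>U. (f has_derivative f' x) (at x)"
      and "\<forall>v. Ck (Suc k) (\<lambda>x. f' x v) U"
    by (auto simp only: Ck.simps(2)[of "Suc k"])
  then show ?case
    using Suc.IH by (auto simp only: Ck.simps(2)[of k])
qed

lemma Ck_SucI:
  assumes "\<And>x. x \<in> U \<Longrightarrow> (f has_derivative f' x) (at x)" and "\<And>v. Ck k (\<lambda>x. f' x v) U"
  shows "Ck (Suc k) f U"
  using assms by auto

lemma Ck_const: "Ck k (\<lambda>x. c) U"
proof (induction k arbitrary: c)
  case (Suc k)
  show ?case
    by (rule Ck_SucI[where f'="\<lambda>x v. 0"]) (auto intro: Suc)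
qed auto

lemma Ck_add:
  assumes "Ck k f U" "Ck k g U"
  shows "Ck k (\<lambda>x. f x + g x) U"
  using assms
proof (induction k arbitrary: f g)
  case 0
  then show ?case by (auto intro: continuous_on_add)
next
  case (Suc k)
  obtain f' where f': "\<And>x. x \<in> U \<Longrightarrow> (f has_derivative f' x) (at x)" "\<And>v. Ck k (\<lambda>x. f' x v) U"
    using Suc.prems(1) by auto
  obtain g' where g': "\<And>x. x \<in> U \<Longrightarrow> (g has_derivative g' x) (at x)" "\<And>v. Ck k (\<lambda>x. g' x v) U"
    using Suc.prems(2) by auto
  show ?case
    by (rule Ck_SucI[where f'="\<lambda>x v. f' x v + g' x v"])
       (auto intro!: has_derivative_add f' g' Suc.IH)
qed

lemma Ck_bounded_bilinear:
  assumes "bounded_bilinear b" "Ck k f U" "Ck k g U"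
  shows "Ck k (\<lambda>x. b (f x) (g x)) U"
  using assms(2,3)
proof (induction k arbitrary: f g)
  case 0
  then show ?case by (auto intro: bounded_bilinear.continuous_on[OF assms(1)])
next
  case (Suc k)
  obtain f' where f': "\<And>x. x \<in> U \<Longrightarrow> (f has_derivative f' x) (at x)" "\<And>v. Ck k (\<lambda>x. f' x v) U"
    using Suc.prems(1) by auto
  obtain g' where g': "\<And>x. x \<in> U \<Longrightarrow> (g has_derivative g' x) (at x)" "\<And>v. Ck k (\<lambda>x. g' x v) U"
    using Suc.prems(2) by auto
  show ?case
    using Suc.prems[THEN Ck_Suc_imp_Ck]
    by (intro Ck_SucI[where f'="\<lambda>x v. b (f x) (g' x v) + b (f' x v) (g x)"])
       (auto intro!: bounded_bilinear.FDERIV[OF assms(1)] f' g' Suc.IH Ck_add)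
qed

lemmas Ck_mult = Ck_bounded_bilinear[OF bounded_bilinear_mult]
lemmas Ck_scaleR = Ck_bounded_bilinear[OF bounded_bilinear_scaleR]

lemma Ck_bounded_linear:
  assumes "bounded_linear f"
  shows "Ck k f U"
proof (cases k)
  case 0
  then show ?thesis by (simp add: assms linear_continuous_on)
next
  case (Suc l)
  show ?thesis
    unfolding Suc
    by (rule Ck_SucI[where f'="\<lambda>x. f"]) (auto intro: bounded_linear_imp_has_derivative assms Ck_const)
qed

lemma Ck_vec3:
  fixes f :: "'a::real_normed_vector \<Rightarrow> real^3"
  assumes "Ck k (\<lambda>x. f x $ 1) U" "Ck k (\<lambda>x. f x $ 2) U" "Ck k (\<lambda>x. f x $ 3) U"
  shows "Ck k f U"
proof -
  have "f = (\<lambda>x. f x $ 1 *\<^sub>R axis 1 1 + f x $ 2 *\<^sub>R axis 2 1 + f x $ 3 *\<^sub>R axis 3 1)"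
    by (auto simp: fun_eq_iff vec_eq_iff forall_3 axis_def)
  moreover have "Ck k (\<lambda>x. f x $ 1 *\<^sub>R axis 1 1 + f x $ 2 *\<^sub>R axis 2 1 + f x $ 3 *\<^sub>R (axis 3 1 :: real^3)) U"
    by (intro Ck_add Ck_scaleR Ck_const assms)
  ultimately show ?thesis by simp
qed

lemma Ck_minus:
  assumes "Ck k f U"
  shows "Ck k (\<lambda>x. - f x) U"
  using Ck_scaleR[OF Ck_const[of k "- 1"] assms] by simp

lemma Ck_diff:
  assumes "Ck k f U" "Ck k g U"
  shows "Ck k (\<lambda>x. f x - g x) U"
  using Ck_add[OF assms(1) Ck_minus[OF assms(2)]] by simp

lemmas Ck_nth = Ck_bounded_linear[OF bounded_linear_vec_nth]

text \<open>The chain rule turns \<open>G n\<close> after \<open>f\<close> into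
  \<open>G (Suc n)\<close> after \<open>f\<close>, times a derivative of \<open>f\<close>. With
  \<open>n\<close> arbitrary, the induction on \<open>k\<close> therefore closes without a general
  theorem on compositions.\<close>

lemma Ck_compose_derivative_tower:
  fixes G :: "nat \<Rightarrow> real \<Rightarrow> real"
  assumes G: "\<And>n s. (G n has_real_derivative G (Suc n) s) (at s)"
    and f: "\<And>j. Ck j f U"
  shows "Ck k (\<lambda>x. G n (f x)) U"
proof (induction k arbitrary: n)
  case 0
  have "continuous_on UNIV (G n)"
    by (meson DERIV_isCont G continuous_at_imp_continuous_on)
  then show ?case
    using f[of 0] by (auto intro: continuous_on_compose2)
next
  case (Suc k)
  obtain f' where f': "\<And>x. x \<in> U \<Longrightarrow> (f has_derivative f' x) (at x)" "\<And>v. Ck k (\<lambda>x. f' x v) U"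
    using f[of "Suc k"] by auto
  show ?case
  proof (rule Ck_SucI[where f'="\<lambda>x v. G (Suc n) (f x) * f' x v"])
    fix x assume "x \<in> U"
    have "(G n has_derivative (\<lambda>h. G (Suc n) (f x) * h)) (at (f x))"
      using G[of n "f x"] by (simp add: has_field_derivative_def)
    from has_derivative_compose[OF f'(1)[OF \<open>x \<in> U\<close>] this]
    show "((\<lambda>x. G n (f x)) has_derivative (\<lambda>v. G (Suc n) (f x) * f' x v)) (at x)" .
  qed (auto intro!: Ck_mult Suc.IH f')
qed

text \<open>\<open>Ck 1\<close> only makes each directional derivative continuous, hence bounded on
  the compact set. Summing over the basis bounds the operator norm, and convexity permits the mean
  value inequality.\<close>

lemma Ck1_imp_lipschitz_on_compact_convex:
  fixes f :: "'a::euclidean_space \<Rightarrow> 'b::real_normed_vector"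
  assumes "Ck 1 f U" "S \<subseteq> U" "compact S" "convex S"
  obtains L where "L > 0" "\<And>x y. x \<in> S \<Longrightarrow> y \<in> S \<Longrightarrow> norm (f x - f y) \<le> L * norm (x - y)"
proof -
  obtain f' where f': "\<And>x. x \<in> U \<Longrightarrow> (f has_derivative f' x) (at x)"
      and cont: "\<And>v. continuous_on U (\<lambda>x. f' x v)"
    using assms(1) by auto
  have "\<exists>M. \<forall>x\<in>S. norm (f' x b) \<le> M" for b
    using compact_imp_bounded[OF compact_continuous_image[OF continuous_on_subset[OF cont assms(2)] assms(3)], of b]
    by (auto simp: bounded_iff)
  then obtain M where M: "\<And>x b. x \<in> S \<Longrightarrow> norm (f' x b) \<le> M b"
    by metis
  \<comment> \<open>The summand 1 makes \<open>L\<close> positive even where all derivatives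
    vanish.\<close>
  define L where "L = (\<Sum>b\<in>Basis. \<bar>M b\<bar>) + 1"
  have "L > 0"
    unfolding L_def by (intro add_nonneg_pos sum_nonneg) auto
  moreover have "norm (f x - f y) \<le> L * norm (x - y)" if "x \<in> S" "y \<in> S" for x y
  proof (rule differentiable_bound[OF assms(4)])
    show "(f has_derivative f' z) (at z within S)" if "z \<in> S" for z
      using that assms(2) f' has_derivative_at_withinI by blast
    show "onorm (f' z) \<le> L" if z: "z \<in> S" for z
    proof (rule onorm_le)
      fix v
      have lin: "linear (f' z)"
        using z assms(2) f' has_derivative_linear by blast
      have "f' z v = (\<Sum>b\<in>Basis. (v \<bullet> b) *\<^sub>R f' z b)"
        by (subst euclidean_representation[of v, symmetric])
           (simp only: linear_sum[OF lin] linear_cmul[OF lin])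
      then have "norm (f' z v) \<le> (\<Sum>b\<in>Basis. \<bar>v \<bullet> b\<bar> * norm (f' z b))"
        by (metis (no_types, lifting) norm_scaleR norm_sum sum.cong)
      also have "\<dots> \<le> (\<Sum>b\<in>Basis. norm v * \<bar>M b\<bar>)"
        using M[OF z] by (intro sum_mono mult_mono) (auto simp: Basis_le_norm intro: order_trans[OF _ abs_ge_self])
      also have "\<dots> \<le> L * norm v"
        by (simp add: L_def sum_distrib_left[symmetric] algebra_simps)
      finally show "norm (f' z v) \<le> L * norm v" .
    qed
  qed (use that in auto)
  ultimately show thesis using that by blast
qed

subsection \<open>Global solutions of Lipschitz differential equations\<close>

lemma has_vector_derivative_reflect:
  assumes "(f has_vector_derivative c) (at (- t))"
  shows "((\<lambda>t. f (- t)) has_vector_derivative - c) (at (t::real))"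
proof -
  have "(uminus has_vector_derivative - 1) (at t)"
    using has_vector_derivative_minus[OF has_vector_derivative_id, of "at t"] by (simp add: id_def)
  from vector_diff_chain_at[OF this assms] show ?thesis
    by (simp add: o_def)
qed

text \<open>A mean value inequality with a time-dependent majorant, in a form covering both
  directions of time at once. Negative times are reduced to positive ones by reversing
  \<open>D\<close>.\<close>

lemma norm_diff_le_of_derivative_bound:
  fixes D :: "real \<Rightarrow> 'a::real_normed_vector"
  assumes D: "\<And>t. (D has_vector_derivative d t) (at t)"
    and B: "\<And>t. (B has_real_derivative B' t) (at t)"
    and bound: "\<And>t. norm (d t) \<le> B' \<bar>t\<bar>"
  shows "norm (D t - D 0) \<le> B \<bar>t\<bar> - B 0"
proof -
  \<comment> \<open>Stated for arbitrary \<open>D\<close> and \<open>d\<close>, because it is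
    applied again to the reversed function.\<close>
  have nonneg: "norm (D t - D 0) \<le> B t - B 0"
    if D: "\<And>t. (D has_vector_derivative d t) (at t)" and bound: "\<And>t. norm (d t) \<le> B' \<bar>t\<bar>"
      and t: "t \<ge> 0" for D :: "real \<Rightarrow> 'a" and d t
  proof (cases "t = 0")
    case False
    show ?thesis
    proof (rule differentiable_bound_general)
      show "continuous_on {0..t} D"
        by (meson D continuous_at_imp_continuous_on has_vector_derivative_continuous)
      show "continuous_on {0..t} B"
        by (meson B DERIV_isCont continuous_at_imp_continuous_on)
      show "norm (d x) \<le> B' x" if "0 < x" for x
        using bound[of x] that by simp
    qed (use B D False t in \<open>auto simp: has_real_derivative_iff_has_vector_derivative\<close>)
  qed auto
  show ?thesis
  proof (cases "t \<ge> 0")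
    case True
    then show ?thesis using nonneg[OF D bound True] by simp
  next
    case False
    have "((\<lambda>t. D (- t)) has_vector_derivative - d (- t)) (at t)" for t
      by (rule has_vector_derivative_reflect[OF D])
    moreover have "norm (- d (- t)) \<le> B' \<bar>t\<bar>" for t
      using bound[of "- t"] by simp
    ultimately show ?thesis
      using nonneg[of "\<lambda>t. D (- t)" "\<lambda>t. - d (- t)" "- t"] False by simp
  qed
qed

lemma interval_integral_has_vector_derivative:
  fixes f :: "real \<Rightarrow> 'a::euclidean_space"
  assumes "continuous_on UNIV f"
  shows "((\<lambda>t. LBINT s=0..t. f s) has_vector_derivative f t) (at t)"
proof -
  define N where "N = \<bar>t\<bar> + 1"
  have "((\<lambda>u. LBINT s=0..u. f s) has_vector_derivative f t) (at t within {-N..N})"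
    unfolding zero_ereal_def
    by (intro interval_integral_FTC2) (auto simp: N_def intro: continuous_on_subset[OF assms])
  moreover have "at t within {-N..N} = at t"
    by (rule at_within_interior) (auto simp: N_def)
  ultimately show ?thesis by simp
qed

text \<open>Picard's operator is a contraction for the norm weighted by \<open>exp (- 2 L \<bar>t\<bar>)\<close>, so that
  the solution exists for all times at once.\<close>

lemma lipschitz_bounded_global_solution:
  fixes W :: "'a::euclidean_space \<Rightarrow> 'a"
  assumes L: "L > 0" and lip: "\<And>x y. norm (W x - W y) \<le> L * norm (x - y)"
    and bounded: "\<And>x. norm (W x) \<le> M"
  shows "\<exists>u. u 0 = x0 \<and> (\<forall>t. (u has_vector_derivative W (u t)) (at t))"
proof -
  \<comment> \<open>The unknown is \<open>v = u / E\<close>, so that the weighted norm of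
    \<open>u\<close> becomes the supremum norm of the bounded continuous function \<open>v\<close>.
    Then \<open>F v\<close> is Picard's operator written in terms of \<open>v\<close>.\<close>
  define E where "E t = exp (2 * L * \<bar>t\<bar>)" for t :: real
  define F where "F v t = x0 + (LBINT s=0..t. W (E s *\<^sub>R v s))" for v :: "real \<Rightarrow> 'a" and t :: real
  have E_pos: "E t > 0" and E_ge: "E t \<ge> 1 + 2 * L * \<bar>t\<bar>" for t
    by (auto simp: E_def)
  have E_cont: "continuous_on UNIV E"
    unfolding E_def by (intro continuous_intros)
  have W_cont: "continuous_on UNIV W"
    using L lip by (intro lipschitz_on_continuous_on[of L] lipschitz_onI) (auto simp: dist_norm)
  have F_0: "F v 0 = x0" for v
    by (simp add: F_def zero_ereal_def)
  have F_deriv: "(F v has_vector_derivative W (E t *\<^sub>R v t)) (at t)"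
    if v: "continuous_on UNIV v" for v t
  proof -
    have "continuous_on UNIV (\<lambda>s. W (E s *\<^sub>R v s))"
      by (intro continuous_on_compose2[OF W_cont] continuous_intros E_cont v) auto
    from interval_integral_has_vector_derivative[OF this] show ?thesis
      unfolding F_def by (auto intro!: derivative_eq_intros)
  qed
  \<comment> \<open>As \<open>W\<close> is bounded, \<open>F v\<close> grows at most linearly, and
    \<open>E\<close> dominates linear growth.\<close>
  have F_mem: "(\<lambda>t. F v t /\<^sub>R E t) \<in> bcontfun" if v: "continuous_on UNIV v" for v
  proof (rule bcontfun_normI)
    have "continuous_on UNIV (F v)"
      by (meson F_deriv v continuous_at_imp_continuous_on has_vector_derivative_continuous)
    then show "continuous_on UNIV (\<lambda>t. F v t /\<^sub>R E t)"
      using E_pos by (intro continuous_intros E_cont) (auto simp: less_imp_neq[symmetric])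
    fix t
    have M0: "M \<ge> 0"
      using bounded[of 0] norm_ge_zero order_trans by blast
    have "norm (F v t - F v 0) \<le> M * \<bar>t\<bar> - M * 0"
      by (rule norm_diff_le_of_derivative_bound[OF F_deriv[OF v], where B'="\<lambda>_. M"])
         (auto intro!: derivative_eq_intros bounded)
    then have "norm (F v t) \<le> norm x0 + M * \<bar>t\<bar>"
      using norm_triangle_ineq2[of "F v t" x0] by (simp add: F_0)
    also have "\<dots> \<le> (norm x0 + M / (2 * L)) * (1 + 2 * L * \<bar>t\<bar>)"
      using L M0 by (simp add: field_simps)
    also have "\<dots> \<le> (norm x0 + M / (2 * L)) * E t"
      using L M0 by (intro mult_left_mono E_ge) auto
    finally show "norm (F v t /\<^sub>R E t) \<le> norm x0 + M / (2 * L)"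
      using E_pos[of t] by (simp add: field_simps)
  qed
  define K where "K v = Bcontfun (\<lambda>t. F (apply_bcontfun v) t /\<^sub>R E t)" for v
  have K_apply: "apply_bcontfun (K v) t = F (apply_bcontfun v) t /\<^sub>R E t" for v t
    unfolding K_def by (simp add: Bcontfun_inverse F_mem)
  have "dist (K v) (K w) \<le> 1/2 * dist v w" for v w
  proof (rule dist_bound)
    fix t
    \<comment> \<open>Integrating the Lipschitz estimate, whose bound is proportional to
      \<open>L * E\<close>, produces \<open>E / 2\<close>. Dividing by \<open>E\<close> leaves the
      contraction factor 1/2.\<close>
    have "norm ((F v t - F w t) - (F v 0 - F w 0))
        \<le> dist v w / 2 * exp (2 * L * \<bar>t\<bar>) - dist v w / 2 * exp (2 * L * 0)"
    proof (rule norm_diff_le_of_derivative_bound[where B'="\<lambda>t. L * dist v w * exp (2 * L * t)"])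
      show "((\<lambda>t. F v t - F w t) has_vector_derivative W (E t *\<^sub>R v t) - W (E t *\<^sub>R w t)) (at t)" for t
        by (intro has_vector_derivative_diff F_deriv) auto
      show "((\<lambda>t. dist v w / 2 * exp (2 * L * t)) has_real_derivative
          L * dist v w * exp (2 * L * t)) (at t)" for t
        by (auto intro!: derivative_eq_intros)
      fix t
      have "norm (W (E t *\<^sub>R v t) - W (E t *\<^sub>R w t)) \<le> L * norm (E t *\<^sub>R v t - E t *\<^sub>R w t)"
        by (rule lip)
      also have "\<dots> = L * (E t * dist (v t) (w t))"
        using E_pos[of t] by (simp add: dist_norm scaleR_diff_right[symmetric])
      also have "\<dots> \<le> L * (E t * dist v w)"
        using L E_pos[of t] by (intro mult_left_mono dist_bounded) auto
      finally show "norm (W (E t *\<^sub>R v t) - W (E t *\<^sub>R w t)) \<le> L * dist v w * exp (2 * L * \<bar>t\<bar>)"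
        by (simp add: E_def ac_simps)
    qed
    then have "norm (F v t - F w t) \<le> dist v w / 2 * E t - dist v w / 2"
      by (simp add: F_0 E_def)
    then have "norm (F v t - F w t) \<le> dist v w / 2 * E t"
      using zero_le_dist[of v w] by linarith
    then show "dist (apply_bcontfun (K v) t) (apply_bcontfun (K w) t) \<le> 1/2 * dist v w"
      using E_pos[of t]
      by (simp only: K_apply dist_norm[where 'a='a] scaleR_diff_right[symmetric] norm_scaleR)
         (simp add: divide_simps mult.commute)
  qed
  then obtain v where v: "K v = v"
    using banach_fix_type[of "1/2" K] by auto
  define u where "u = F (apply_bcontfun v)"
  have u_v: "u t = E t *\<^sub>R apply_bcontfun v t" for t
    using K_apply[of v t] E_pos[of t] by (simp add: v u_def)
  have "(u has_vector_derivative W (u t)) (at t)" for t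
    unfolding u_v[of t] unfolding u_def by (rule F_deriv) auto
  moreover have "u 0 = x0"
    by (simp add: u_def F_0)
  ultimately show ?thesis by blast
qed

text \<open>For \<open>w = u - v\<close> the function \<open>(w \<bullet> w) * exp (- 2 K t)\<close>
  has nonpositive derivative; negative times follow by reversal. With equal starting points this is
  uniqueness, otherwise continuous dependence. Since only the derivatives along the two curves are
  compared, equations with time-dependent coefficients are included.\<close>

lemma gronwall_difference:
  fixes u v :: "real \<Rightarrow> 'a::real_inner"
  assumes u: "\<And>t. (u has_vector_derivative a t) (at t)"
    and v: "\<And>t. (v has_vector_derivative b t) (at t)"
    and lip: "\<And>t. norm (a t - b t) \<le> K * norm (u t - v t)"
  shows "norm (u t - v t) \<le> exp (K * \<bar>t\<bar>) * norm (u 0 - v 0)"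
proof -
  have nonneg: "norm (w t) \<le> exp (K * t) * norm (w 0)"
    if w: "\<And>t. (w has_vector_derivative c t) (at t)" and c: "\<And>t. norm (c t) \<le> K * norm (w t)"
      and t: "t \<ge> 0" for w c :: "real \<Rightarrow> 'a" and t
  proof -
    define G where "G t = (w t \<bullet> w t) * exp (- (2 * (K * t)))" for t
    have "\<exists>y. (G has_real_derivative y) (at s) \<and> y \<le> 0" for s
    proof -
      have "((\<lambda>t. w t \<bullet> w t) has_vector_derivative 2 * (w s \<bullet> c s)) (at s)"
        using bounded_bilinear.has_vector_derivative[OF bounded_bilinear_inner w w]
        by (simp add: inner_commute)
      then have "((\<lambda>t. w t \<bullet> w t) has_real_derivative 2 * (w s \<bullet> c s)) (at s)"
        by (simp add: has_real_derivative_iff_has_vector_derivative)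
      then have "(G has_real_derivative 2 * (w s \<bullet> c s - K * (w s \<bullet> w s)) * exp (- (2 * (K * s)))) (at s)"
        unfolding G_def by (auto intro!: derivative_eq_intros simp: algebra_simps)
      moreover have "w s \<bullet> c s \<le> K * (w s \<bullet> w s)"
      proof -
        have "w s \<bullet> c s \<le> norm (w s) * norm (c s)" by (rule norm_cauchy_schwarz)
        also have "\<dots> \<le> norm (w s) * (K * norm (w s))" by (intro mult_left_mono c) auto
        finally show ?thesis by (simp add: dot_square_norm power2_eq_square ac_simps)
      qed
      ultimately show ?thesis
        by (intro exI conjI) (auto simp: mult_le_0_iff)
    qed
    then have "G t \<le> G 0"
      using DERIV_nonpos_imp_nonincreasing[of 0 t G] t by blast
    then have "(norm (w t))\<^sup>2 \<le> (exp (K * t) * norm (w 0))\<^sup>2"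
      unfolding G_def dot_square_norm exp_minus power_mult_distrib exp_double
      by (simp add: divide_simps mult.commute)
    then show ?thesis
      by (rule power2_le_imp_le) auto
  qed
  have w: "((\<lambda>t. u t - v t) has_vector_derivative a t - b t) (at t)" for t
    by (intro has_vector_derivative_diff u v)
  show ?thesis
  proof (cases "t \<ge> 0")
    case True
    then show ?thesis using nonneg[OF w lip True] by simp
  next
    case False
    have "((\<lambda>t. u (- t) - v (- t)) has_vector_derivative - (a (- t) - b (- t))) (at t)" for t
      by (rule has_vector_derivative_reflect[OF w])
    moreover have "norm (- (a (- t) - b (- t))) \<le> K * norm (u (- t) - v (- t))" for t
      using lip[of "- t"] by (simp only: norm_minus_cancel)
    ultimately show ?thesis
      using nonneg[of "\<lambda>t. u (- t) - v (- t)" "\<lambda>t. - (a (- t) - b (- t))" "- t"] False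
      by simp
  qed
qed

subsection \<open>Flows on the sphere\<close>

lemma S2_iff: "x \<in> S2 \<longleftrightarrow> (x$1)\<^sup>2 + (x$2)\<^sup>2 + (x$3)\<^sup>2 = 1"
  by (simp add: S2_def norm_eq_1 inner_vec_def sum_3 power2_eq_square)

lemma inner_derivative_zero_imp_norm_const:
  fixes u :: "real \<Rightarrow> 'a::real_inner"
  assumes "\<And>t. (u has_vector_derivative a t) (at t)" and "\<And>t. a t \<bullet> u t = 0"
  shows "norm (u t) = norm (u 0)"
proof -
  have "((\<lambda>t. u t \<bullet> u t) has_real_derivative 0) (at t)" for t
    using bounded_bilinear.has_vector_derivative[OF bounded_bilinear_inner assms(1) assms(1), of t] assms(2)[of t]
    by (simp add: inner_commute has_real_derivative_iff_has_vector_derivative)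
  then have "u t \<bullet> u t = u 0 \<bullet> u 0"
    using DERIV_isconst_all by blast
  then show ?thesis by (simp add: norm_eq_sqrt_inner)
qed

text \<open>The point of interest is that the projection is radial: a field tangent to all spheres
  stays orthogonal to the position after being evaluated at the projected point.\<close>

lemma closest_point_unit_ball_outside:
  fixes x :: "'a::euclidean_space"
  assumes "norm x > 1"
  shows "closest_point (cball 0 1) x = x /\<^sub>R norm x"
proof (rule closest_point_unique[symmetric])
  have x: "x - x /\<^sub>R norm x = (1 - 1 / norm x) *\<^sub>R x"
    by (simp add: scaleR_diff_left divide_inverse)
  have "norm (x - x /\<^sub>R norm x) = norm x - 1"
  proof -
    have "1 - 1 / norm x \<ge> 0" "norm x \<noteq> 0"
      using assms divide_le_eq_1[of 1 "norm x"] by linarith+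
    then show ?thesis
      unfolding x norm_scaleR by (simp add: left_diff_distrib)
  qed
  moreover have "norm x - 1 \<le> norm (x - z)" if "norm z \<le> 1" for z
    using norm_triangle_ineq2[of x z] that by linarith
  ultimately show "\<forall>z\<in>cball 0 1. dist x (x /\<^sub>R norm x) \<le> dist x z"
    by (simp add: dist_norm)
  have "x \<noteq> 0" using assms by auto
  then show "x /\<^sub>R norm x \<in> cball 0 1" by simp
qed auto

text \<open>Composing \<open>V\<close> with the nearest-point projection \<open>p\<close> onto the
  unit ball makes it bounded and globally Lipschitz without changing it on the sphere. Since
  \<open>p\<close> is radial outside the ball, the new field is still orthogonal to the position, so
  solutions keep their norm and the sphere is invariant.\<close>

lemma tangent_field_has_flow_S2:
  fixes V :: "real^3 \<Rightarrow> real^3"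
  assumes C1: "Ck 1 V UNIV" and tangent: "\<And>x. V x \<bullet> x = 0"
  shows "\<exists>\<phi>. is_flow_S2 \<phi> \<and> (\<forall>x\<in>S2. \<forall>t. (\<phi> x has_vector_derivative V (\<phi> x t)) (at t))"
proof -
  define p :: "real^3 \<Rightarrow> real^3" where "p = closest_point (cball 0 1)"
  have p_in: "p x \<in> cball 0 1" for x
    unfolding p_def by (rule closest_point_in_set) auto
  have p_lip: "norm (p x - p y) \<le> norm (x - y)" for x y
    using closest_point_lipschitz[of "cball (0::real^3) 1" x y] by (simp add: p_def dist_norm)
  have p_id: "p x = x" if "norm x \<le> 1" for x
    using that by (simp add: p_def closest_point_self)
  obtain L where L: "L > 0"
    and V_lip: "\<And>x y. x \<in> cball 0 1 \<Longrightarrow> y \<in> cball 0 1 \<Longrightarrow> norm (V x - V y) \<le> L * norm (x - y)"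
    using Ck1_imp_lipschitz_on_compact_convex[OF C1, of "cball 0 1"] by (auto simp: convex_cball)
  have W_lip: "norm (V (p x) - V (p y)) \<le> L * norm (x - y)" for x y
    using V_lip[OF p_in p_in, of x y] p_lip[of x y] L
    by (meson less_imp_le mult_left_mono order_trans)
  have "norm (V (p x)) \<le> L + norm (V 0)" for x
  proof -
    have "norm (V (p x) - V 0) \<le> L * norm (p x - 0)"
      by (intro V_lip p_in) auto
    also have "\<dots> \<le> L * 1"
      using p_in[of x] L by (intro mult_left_mono) auto
    finally show ?thesis
      using norm_triangle_ineq2[of "V (p x)" "V 0"] by linarith
  qed
  then have "\<exists>u. u 0 = x \<and> (\<forall>t. (u has_vector_derivative V (p (u t))) (at t))" for x
    using lipschitz_bounded_global_solution[of L "\<lambda>x. V (p x)"] L W_lip by blast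
  then obtain u where u0: "\<And>x. u x 0 = x"
    and u': "\<And>x t. (u x has_vector_derivative V (p (u x t))) (at t)"
    by metis
  have W_tangent: "V (p x) \<bullet> x = 0" for x
  proof (cases "norm x \<le> 1")
    case False
    then have px: "p x = x /\<^sub>R norm x"
      unfolding p_def by (intro closest_point_unit_ball_outside) auto
    have "x \<noteq> 0"
      using False by auto
    then have "V (p x) \<bullet> x = norm x * (V (p x) \<bullet> p x)"
      by (simp add: px)
    then show ?thesis by (simp add: tangent)
  qed (simp add: p_id tangent)
  have S2: "u x t \<in> S2" if "x \<in> S2" for x t
    using inner_derivative_zero_imp_norm_const[of "u x", OF u' W_tangent] that
    by (simp add: S2_def u0)
  have W_eq: "V (p x) = V x" if "x \<in> S2" for x
    using that by (simp add: S2_def p_id)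
  have "u (u x s) t = u x (s + t)" for x s t
  proof -
    \<comment> \<open>The group law is uniqueness: the time-shifted solution solves the same
      equation and starts at \<open>u x s\<close>.\<close>
    have "((\<lambda>t. u x (s + t)) has_vector_derivative V (p (u x (s + t)))) (at t)" for t
    proof -
      have "((+) s has_vector_derivative 1) (at t)"
        using has_vector_derivative_add[OF has_vector_derivative_const[of s] has_vector_derivative_id[of "at t"]]
        by simp
      from vector_diff_chain_at[OF this u'] show ?thesis
        by (simp add: o_def)
    qed
    from gronwall_difference[OF u' this W_lip, of "u x s" t] show ?thesis
      by (simp add: u0)
  qed
  moreover have "continuous_on (S2 \<times> UNIV) (\<lambda>(x,t). u x t)"
  proof (rule continuous_at_imp_continuous_on, safe)
    fix x :: "real^3" and t :: real
    have "((\<lambda>z. exp (L * \<bar>snd z\<bar>) * norm (fst z - x)) \<longlongrightarrow> exp (L * \<bar>t\<bar>) * norm (x - x)) (at (x,t))"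
      by (intro tendsto_intros tendsto_fst[THEN tendsto_eq_rhs] tendsto_snd[THEN tendsto_eq_rhs]) auto
    then have lim: "((\<lambda>z. exp (L * \<bar>snd z\<bar>) * norm (fst z - x)) \<longlongrightarrow> 0) (at (x,t))"
      by simp
    \<comment> \<open>Joint continuity is split in two: this estimate handles the change of starting
      point, locally uniformly in time, and the continuity of the single curve \<open>u x\<close>
      handles the change of time.\<close>
    have "norm (u y s - u x s) \<le> exp (L * \<bar>s\<bar>) * norm (y - x)" for y s
      using gronwall_difference[OF u' u' W_lip, of y s x] by (simp only: u0)
    then have "((\<lambda>z. u (fst z) (snd z) - u x (snd z)) \<longlongrightarrow> 0) (at (x,t))"
      by (intro Lim_null_comparison[OF _ lim] always_eventually allI)
    moreover have "((\<lambda>z. u x (snd z)) \<longlongrightarrow> u x t) (at (x,t))"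
      by (rule isCont_tendsto_compose[OF has_vector_derivative_continuous[OF u'[of x t]]])
         (rule tendsto_snd[OF tendsto_ident_at, THEN tendsto_eq_rhs], simp)
    ultimately have "((\<lambda>z. u (fst z) (snd z) - u x (snd z) + u x (snd z)) \<longlongrightarrow> 0 + u x t) (at (x,t))"
      by (rule tendsto_add)
    then have "((\<lambda>z. u (fst z) (snd z)) \<longlongrightarrow> u x t) (at (x,t))"
      by simp
    then show "isCont (\<lambda>(x,t). u x t) (x,t)"
      by (simp add: isCont_def case_prod_unfold)
  qed
  ultimately have "is_flow_S2 u"
    by (simp add: is_flow_S2_def S2 u0)
  then show ?thesis
    using u' W_eq S2 by metis
qed

subsection \<open>A flat oscillating function\<close>

definition flat_osc :: "real \<Rightarrow> real" where
  "flat_osc s = (if s > 0 then exp (- 1 / s) * sin (1 / s) else 0)"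

text \<open>Functions of this shape are closed under differentiation, and \<open>flat_osc\<close> is the case of
  the constant polynomial \<open>\<i>\<close>.\<close>

definition flat_poly :: "complex poly \<Rightarrow> real \<Rightarrow> real" where
  "flat_poly p s = (if s > 0 then Re (exp (- Complex 1 1 * of_real (1 / s)) * poly p (of_real (1 / s))) else 0)"

text \<open>With \<open>w = 1 / s\<close> and \<open>c = 1 + i\<close>, differentiating
  \<open>exp (- c w) * p w\<close> with respect to \<open>w\<close> gives
  \<open>exp (- c w) * (p' w - c * p w)\<close>. The factor \<open>w^2\<close> and the change of
  sign come from \<open>dw/ds = - w^2\<close>.\<close>

definition flat_step :: "complex poly \<Rightarrow> complex poly" where
  "flat_step p = [:0, 0, 1:] * (smult (Complex 1 1) p - pderiv p)"

lemma flat_osc_eq: "flat_osc = flat_poly [:\<i>:]"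
  by (rule ext) (auto simp: flat_osc_def flat_poly_def exp_eq_polar cis.code Re_exp Im_exp)

text \<open>The power \<open>w ^ n\<close> drives the induction, since \<open>pCons\<close>
  multiplies the remaining polynomial by \<open>w\<close>. The case \<open>n = 1\<close> controls
  the difference quotient of \<open>flat_poly\<close> at 0.\<close>

lemma poly_times_exp_minus_tendsto_0:
  "((\<lambda>w. w ^ n * exp (- w) * norm (poly p (complex_of_real w))) \<longlongrightarrow> 0) at_top"
proof (induction p arbitrary: n)
  case (pCons a p)
  have "((\<lambda>w::real. norm a * (w ^ n / exp w) + w ^ Suc n * exp (- w) * norm (poly p (complex_of_real w)))
      \<longlongrightarrow> norm a * 0 + 0) at_top"
    by (intro tendsto_intros tendsto_power_div_exp_0 pCons.IH)
  then have lim: "((\<lambda>w::real. norm a * (w ^ n / exp w) + w ^ Suc n * exp (- w) * norm (poly p (complex_of_real w)))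
      \<longlongrightarrow> 0) at_top"
    by simp
  show ?case
  proof (rule Lim_null_comparison[OF _ lim], rule eventually_mono[OF eventually_ge_at_top[of 0]])
    fix w :: real assume w: "w \<ge> 0"
    have "norm (poly (pCons a p) (complex_of_real w)) \<le> norm a + w * norm (poly p (complex_of_real w))"
      using norm_triangle_ineq[of a "complex_of_real w * poly p (complex_of_real w)"] w
      by (simp add: norm_mult)
    then have "w ^ n * exp (- w) * norm (poly (pCons a p) (complex_of_real w))
        \<le> w ^ n * exp (- w) * (norm a + w * norm (poly p (complex_of_real w)))"
      using w by (intro mult_left_mono) auto
    then show "norm (w ^ n * exp (- w) * norm (poly (pCons a p) (complex_of_real w)))
        \<le> norm a * (w ^ n / exp w) + w ^ Suc n * exp (- w) * norm (poly p (complex_of_real w))"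
      using w by (simp add: exp_minus field_simps)
  qed
qed auto

lemma flat_poly_deriv: "(flat_poly p has_real_derivative flat_poly (flat_step p) s) (at s)"
proof -
  consider "s < 0" | "s > 0" | "s = 0" by linarith
  then show ?thesis
  proof cases
    case 1
    have "((\<lambda>_. 0) has_real_derivative 0) (at s)" by simp
    moreover have "eventually (\<lambda>s. 0 = flat_poly p s) (nhds s)"
      using eventually_nhds_in_open[of "{..<0}" s] 1
      by (auto simp: flat_poly_def elim!: eventually_mono)
    ultimately show ?thesis
      using 1 DERIV_cong_ev[of s s "\<lambda>_. 0" "flat_poly p" 0 0] by (simp add: flat_poly_def)
  next
    case 2
    define c where "c = Complex 1 1"
    define H where "H w = exp (- c * w) * poly p w" for w
    have H: "(H has_field_derivative exp (- c * w) * (poly (pderiv p) w - c * poly p w)) (at w)" for w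
      unfolding H_def by (auto intro!: derivative_eq_intros simp: algebra_simps)
    have "((\<lambda>s. complex_of_real (1 / s)) has_vector_derivative of_real (- (1 / s)\<^sup>2)) (at s)"
      using 2 by (intro has_vector_derivative_of_real)
        (auto intro!: derivative_eq_intros simp: power2_eq_square)
    from field_vector_diff_chain_at[OF this H]
    have "((\<lambda>s. Re (H (of_real (1 / s)))) has_vector_derivative
        Re (of_real (- (1 / s)\<^sup>2) * (exp (- c * of_real (1 / s))
          * (poly (pderiv p) (of_real (1 / s)) - c * poly p (of_real (1 / s)))))) (at s)"
      unfolding o_def by (rule bounded_linear.has_vector_derivative[OF bounded_linear_Re])
    also have "of_real (- (1 / s)\<^sup>2) * (exp (- c * of_real (1 / s))
          * (poly (pderiv p) (of_real (1 / s)) - c * poly p (of_real (1 / s))))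
       = exp (- c * of_real (1 / s)) * poly (flat_step p) (of_real (1 / s))"
      by (simp add: flat_step_def c_def power2_eq_square algebra_simps)
    also have "Re \<dots> = flat_poly (flat_step p) s"
      using 2 by (simp add: flat_poly_def c_def)
    finally have "((\<lambda>s. Re (H (of_real (1 / s)))) has_real_derivative flat_poly (flat_step p) s) (at s)"
      by (simp add: has_real_derivative_iff_has_vector_derivative)
    then show ?thesis
    proof (rule DERIV_cong_ev[OF refl _ refl, THEN iffD1, rotated])
      show "eventually (\<lambda>s. Re (H (of_real (1 / s))) = flat_poly p s) (nhds s)"
        using eventually_nhds_in_open[of "{0<..}" s] 2
        by (auto simp: flat_poly_def H_def c_def elim!: eventually_mono)
    qed
  next
    \<comment> \<open>The left quotient is zero. The right one is at most
      \<open>w * exp (- w) * norm (poly p w)\<close> with \<open>w = 1 / h\<close>, which tends to 0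
      as \<open>w\<close> grows.\<close>
    case 3
    have "((\<lambda>h. flat_poly p h / h) \<longlongrightarrow> 0) (at_left 0)"
      by (rule tendsto_eventually)
         (auto simp: flat_poly_def eventually_at_filter intro!: always_eventually)
    moreover have "((\<lambda>h. flat_poly p h / h) \<longlongrightarrow> 0) (at_right 0)"
    proof (rule Lim_null_comparison)
      show "((\<lambda>h. inverse h ^ 1 * exp (- inverse h) * norm (poly p (complex_of_real (inverse h)))) \<longlongrightarrow> 0) (at_right 0)"
        by (rule filterlim_compose[OF poly_times_exp_minus_tendsto_0 filterlim_inverse_at_top_right])
      show "eventually (\<lambda>h. norm (flat_poly p h / h) \<le>
          inverse h ^ 1 * exp (- inverse h) * norm (poly p (complex_of_real (inverse h)))) (at_right 0)"
        unfolding eventually_at_filter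
      proof (intro always_eventually allI impI)
        fix h :: real assume "h \<in> {0<..}"
        then have h: "h > 0" by simp
        have "\<bar>flat_poly p h\<bar> \<le> norm (exp (- Complex 1 1 * of_real (1 / h)) * poly p (of_real (1 / h)))"
          unfolding flat_poly_def if_P[OF h] by (rule abs_Re_le_cmod)
        also have "\<dots> = exp (- inverse h) * norm (poly p (complex_of_real (inverse h)))"
          by (simp add: norm_mult divide_inverse del: of_real_inverse)
        finally have "\<bar>flat_poly p h\<bar> \<le> exp (- inverse h) * norm (poly p (complex_of_real (inverse h)))" .
        from mult_left_mono[OF this, of "inverse h"] h
        show "norm (flat_poly p h / h) \<le>
          inverse h ^ 1 * exp (- inverse h) * norm (poly p (complex_of_real (inverse h)))"
          by (simp add: divide_inverse abs_mult mult.commute mult.left_commute del: of_real_inverse)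
      qed
    qed
    ultimately have "((\<lambda>h. flat_poly p h / h) \<longlongrightarrow> 0) (at 0)"
      by (rule filterlim_split_at)
    then show ?thesis
      by (simp add: 3 DERIV_def flat_poly_def)
  qed
qed

lemma Ck_flat_osc:
  assumes "\<And>j. Ck j f U"
  shows "Ck k (\<lambda>x. flat_osc (f x)) U"
proof -
  have "((\<lambda>s. flat_poly ((flat_step ^^ n) [:\<i>:]) s) has_real_derivative
      flat_poly ((flat_step ^^ Suc n) [:\<i>:]) s) (at s)" for n s
    using flat_poly_deriv[of "(flat_step ^^ n) [:\<i>:]" s] by simp
  from Ck_compose_derivative_tower[of "\<lambda>n. flat_poly ((flat_step ^^ n) [:\<i>:])", OF this assms, of k 0]
  show ?thesis by (simp add: flat_osc_eq)
qed

lemma flat_osc_zero_iff: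
  assumes "s > 0"
  shows "flat_osc s = 0 \<longleftrightarrow> (\<exists>k. s = 1 / (real (Suc k) * pi))"
proof
  assume "flat_osc s = 0"
  then have "sin (1 / s) = 0"
    using assms by (simp add: flat_osc_def)
  then obtain i :: int where i: "1 / s = of_int i * pi"
    using sin_zero_iff_int2 by blast
  then have "of_int i * pi > 0"
    using assms by (metis zero_less_divide_1_iff)
  then have "i > 0"
    by (simp add: zero_less_mult_iff)
  then obtain k where "i = int (Suc k)"
    by (metis Suc_pred zero_less_imp_eq_int)
  then have "1 / s = real (Suc k) * pi"
    using i by simp
  then have "s = 1 / (real (Suc k) * pi)"
    by (metis divide_divide_eq_right mult_1 div_by_1)
  then show "\<exists>k. s = 1 / (real (Suc k) * pi)" ..
next
  assume "\<exists>k. s = 1 / (real (Suc k) * pi)"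
  then obtain k where "1 / s = real (Suc k) * pi"
    by force
  then show "flat_osc s = 0"
    unfolding flat_osc_def by (simp only: sin_npi) simp
qed

subsection \<open>Spiralling flows\<close>

text \<open>Unit rotation about the vertical axis plus \<open>flat_osc\<close> times the tangential
  part of the upward unit vector. Writing the last entry as \<open>x\<^sup>2 + y\<^sup>2\<close>
  rather than \<open>1 - z\<^sup>2\<close> makes the field orthogonal to the position on the whole
  space.\<close>

definition spiral :: "real^3 \<Rightarrow> real^3" where
  "spiral x = vector
     [- x$2 - flat_osc (1 - x$3) * (x$1 * x$3),
      x$1 - flat_osc (1 - x$3) * (x$2 * x$3),
      flat_osc (1 - x$3) * ((x$1)\<^sup>2 + (x$2)\<^sup>2)]"

lemma spiral_nth [simp]:
  "spiral x $ 1 = - x$2 - flat_osc (1 - x$3) * (x$1 * x$3)"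
  "spiral x $ 2 = x$1 - flat_osc (1 - x$3) * (x$2 * x$3)"
  "spiral x $ 3 = flat_osc (1 - x$3) * ((x$1)\<^sup>2 + (x$2)\<^sup>2)"
  by (simp_all add: spiral_def)

lemma spiral_tangent: "spiral x \<bullet> x = 0"
  by (simp add: inner_vec_def sum_3 power2_eq_square algebra_simps)

lemma Ck_spiral: "Ck k spiral U"
  by (intro Ck_vec3; unfold spiral_nth power2_eq_square;
      intro Ck_add Ck_diff Ck_minus Ck_mult Ck_nth Ck_flat_osc Ck_const)

section \<open>Rotations about the vertical axis\<close>

definition zrot :: "real \<Rightarrow> real^3 \<Rightarrow> real^3" where
  "zrot a x = vector [cos a * x$1 - sin a * x$2, sin a * x$1 + cos a * x$2, x$3]"

lemma zrot_nth [simp]: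
  "zrot a x $ 1 = cos a * x$1 - sin a * x$2"
  "zrot a x $ 2 = sin a * x$1 + cos a * x$2"
  "zrot a x $ 3 = x$3"
  by (simp_all add: zrot_def)

lemma zrot_sum_squares: "(zrot a x $ 1)\<^sup>2 + (zrot a x $ 2)\<^sup>2 = (x$1)\<^sup>2 + (x$2)\<^sup>2"
proof -
  have "(zrot a x $ 1)\<^sup>2 + (zrot a x $ 2)\<^sup>2 = ((cos a)\<^sup>2 + (sin a)\<^sup>2) * ((x$1)\<^sup>2 + (x$2)\<^sup>2)"
    by (simp only: zrot_nth) algebra
  then show ?thesis by (simp only: sin_cos_squared_add2 mult_1)
qed

lemma zrot_in_S2: "x \<in> S2 \<Longrightarrow> zrot a x \<in> S2"
  using zrot_sum_squares[of a x] by (simp add: S2_iff)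

lemma zrot_2pi: "zrot (2 * pi) x = x"
  by (simp add: vec_eq_iff forall_3)

lemma zrot_has_vector_derivative:
  "((\<lambda>t. zrot (c * t) x) has_vector_derivative
     c *\<^sub>R vector [- (zrot (c * t) x $ 2), zrot (c * t) x $ 1, 0]) (at t)"
proof -
  define p q w :: "real^3" where "p = vector [x$1, x$2, 0]" and "q = vector [- x$2, x$1, 0]"
    and "w = vector [0, 0, x$3]"
  have eq: "zrot a x = cos a *\<^sub>R p + sin a *\<^sub>R q + w" for a
    by (simp add: vec_eq_iff forall_3 p_def q_def w_def)
  have "((\<lambda>t. cos (c * t) *\<^sub>R p + sin (c * t) *\<^sub>R q + w) has_vector_derivative
      (- (c * sin (c * t))) *\<^sub>R p + (c * cos (c * t)) *\<^sub>R q) (at t)"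
    by (auto intro!: derivative_eq_intros simp: mult.commute)
  also have "(- (c * sin (c * t))) *\<^sub>R p + (c * cos (c * t)) *\<^sub>R q
      = c *\<^sub>R vector [- (zrot (c * t) x $ 2), zrot (c * t) x $ 1, 0]"
    by (simp add: vec_eq_iff forall_3 p_def q_def algebra_simps)
  finally show ?thesis
    by (simp add: eq)
qed

lemma same_height_imp_zrot:
  assumes "x \<in> S2" "y \<in> S2" "x$3 = y$3"
  obtains a where "y = zrot a x"
proof (cases "(x$1)\<^sup>2 + (x$2)\<^sup>2 = 0")
  case True
  then have "(y$1)\<^sup>2 + (y$2)\<^sup>2 = 0"
    using assms by (simp add: S2_iff)
  with True assms(3) have "y = zrot 0 x"
    by (simp add: vec_eq_iff forall_3 sum_power2_eq_zero_iff)
  then show thesis by (rule that)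
next
  case False
  define R where "R = (x$1)\<^sup>2 + (x$2)\<^sup>2"
  have Ry: "(y$1)\<^sup>2 + (y$2)\<^sup>2 = R"
    using assms by (simp add: S2_iff R_def)
  have R0: "R \<noteq> 0"
    using False by (simp add: R_def)
  \<comment> \<open>Cosine and sine of the angle between the horizontal parts, as normalised inner
    and cross products. Lagrange's identity gives \<open>C\<^sup>2 + S\<^sup>2 = 1\<close>.\<close>
  define C S where "C = (x$1 * y$1 + x$2 * y$2) / R" and "S = (x$1 * y$2 - x$2 * y$1) / R"
  have "(x$1 * y$1 + x$2 * y$2)\<^sup>2 + (x$1 * y$2 - x$2 * y$1)\<^sup>2
      = ((x$1)\<^sup>2 + (x$2)\<^sup>2) * ((y$1)\<^sup>2 + (y$2)\<^sup>2)"
    by algebra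
  also have "\<dots> = R\<^sup>2"
    using Ry by (simp add: R_def power2_eq_square)
  finally have "C\<^sup>2 + S\<^sup>2 = 1"
    using R0 by (simp add: C_def S_def power_divide add_divide_distrib[symmetric])
  then obtain a where a: "C = cos a" "S = sin a"
    using sincos_total_2pi by metis
  have "C * x$1 - S * x$2 = ((x$1)\<^sup>2 + (x$2)\<^sup>2) * y$1 / R"
    by (simp add: C_def S_def diff_divide_distrib[symmetric] power2_eq_square algebra_simps)
  moreover have "S * x$1 + C * x$2 = ((x$1)\<^sup>2 + (x$2)\<^sup>2) * y$2 / R"
    by (simp add: C_def S_def add_divide_distrib[symmetric] power2_eq_square algebra_simps)
  ultimately have "y = zrot a x"
    using R0 assms(3) by (simp add: vec_eq_iff forall_3 a R_def[symmetric])
  then show thesis by (rule that)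
qed

section \<open>The heights of the closed orbits\<close>

definition level :: "real \<Rightarrow> (real^3) set" where
  "level z = {x \<in> S2. x$3 = z}"

definition ring_height :: "nat \<Rightarrow> real" where
  "ring_height k = 1 - 1 / (real (Suc k) * pi)"

text \<open>On the sphere these are exactly the heights at which the vertical drift vanishes: the
  two poles and the zeros of \<open>flat_osc (1 - z)\<close>.\<close>

definition critical :: "real \<Rightarrow> bool" where
  "critical z \<longleftrightarrow> z = 1 \<or> z = - 1 \<or> z \<in> range ring_height"

lemma one_minus_ring_height: "1 - ring_height k = 1 / (real (Suc k) * pi)"
  by (simp add: ring_height_def)

lemma ring_height_bounds: "0 < ring_height k" "ring_height k < 1"
proof -
  have "real (Suc k) * pi \<ge> 1 * pi"
    by (intro mult_right_mono) auto
  then have "real (Suc k) * pi > 1"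
    using pi_gt3 by linarith
  then show "0 < ring_height k" "ring_height k < 1"
    by (simp_all add: ring_height_def)
qed

lemma inj_ring_height: "inj ring_height"
  by (rule injI) (simp add: ring_height_def)

lemma abs_height_le_1:
  assumes "x \<in> S2"
  shows "\<bar>x$3\<bar> \<le> 1"
proof -
  have "(x$3)\<^sup>2 \<le> 1"
    using assms sum_power2_ge_zero[of "x$1" "x$2"] unfolding S2_iff by linarith
  then show ?thesis
    by (simp add: abs_square_le_1)
qed

lemma pole_iff:
  assumes "x \<in> S2"
  shows "(x$1)\<^sup>2 + (x$2)\<^sup>2 = 0 \<longleftrightarrow> x$3 = 1 \<or> x$3 = - 1"
proof -
  have "(x$1)\<^sup>2 + (x$2)\<^sup>2 = 0 \<longleftrightarrow> (x$3)\<^sup>2 = 1"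
    using assms unfolding S2_iff by linarith
  then show ?thesis
    by (simp add: power2_eq_1_iff)
qed

lemma zrot_north_pole:
  assumes "x \<in> S2" "x$3 = 1"
  shows "zrot a x = x"
  using assms pole_iff[OF assms(1)] by (simp add: vec_eq_iff forall_3 sum_power2_eq_zero_iff)

lemma critical_iff:
  assumes "x \<in> S2"
  shows "critical (x$3) \<longleftrightarrow> (x$1)\<^sup>2 + (x$2)\<^sup>2 = 0 \<or> flat_osc (1 - x$3) = 0"
proof (cases "x$3 = 1")
  case False
  then have "1 - x$3 > 0"
    using abs_height_le_1[OF assms] by linarith
  then show ?thesis
    unfolding critical_def pole_iff[OF assms] flat_osc_zero_iff[OF \<open>1 - x$3 > 0\<close>]
    by (auto simp: ring_height_def image_iff algebra_simps)
qed (simp add: critical_def flat_osc_def)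

lemma spiral_critical:
  assumes "x \<in> S2" "critical (x$3)"
  shows "spiral x = vector [- x$2, x$1, 0]"
proof (cases "flat_osc (1 - x$3) = 0")
  case False
  then have "x$1 = 0 \<and> x$2 = 0"
    using assms critical_iff by (simp add: sum_power2_eq_zero_iff)
  then show ?thesis
    by (simp add: vec_eq_iff forall_3)
qed (simp add: vec_eq_iff forall_3)

lemma level_ring_height_nonempty: "\<exists>x. x \<in> level (ring_height k)"
proof -
  have "(ring_height k)\<^sup>2 \<le> 1"
    using ring_height_bounds[of k] by (simp add: power_le_one)
  then have "vector [sqrt (1 - (ring_height k)\<^sup>2), 0, ring_height k] \<in> level (ring_height k)"
    by (simp add: level_def S2_iff)
  then show ?thesis ..
qed

lemma one_over_lessD: "1 / a < 1 / b \<Longrightarrow> 0 < a \<Longrightarrow> 0 < b \<Longrightarrow> b < (a::real)"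
  by (simp add: field_simps)

text \<open>In the coordinate \<open>1 / (1 - z)\<close> the rings sit at the positive multiples of
  \<open>pi\<close>, and the window from \<open>(k + 1/2) pi\<close> to \<open>(k + 3/2) pi\<close>
  contains only one of them. The window also lies in \<open>0 < z < 1\<close>, which excludes the
  poles.\<close>

lemma ring_height_separated:
  assumes "critical z" "1 - 1 / ((real k + 1/2) * pi) < z" "z < 1 - 1 / ((real k + 3/2) * pi)"
  shows "z = ring_height k"
proof -
  have "1 / ((real k + 1/2) * pi) \<le> 1 / (1/2 * pi)"
    by (intro divide_left_mono mult_right_mono) auto
  moreover have "1 / (1/2 * pi) < 1"
    using pi_gt3 by simp
  ultimately have "z > 0" using assms(2) by linarith
  moreover have "1 / ((real k + 3/2) * pi) > 0"
    by (simp add: add_nonneg_pos)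
  then have "z < 1" using assms(3) by linarith
  ultimately obtain j where j: "z = ring_height j"
    using assms(1) by (auto simp: critical_def)
  have "1 / (real (Suc j) * pi) < 1 / ((real k + 1/2) * pi)"
    using assms(2) by (simp add: j ring_height_def)
  then have "(real k + 1/2) * pi < real (Suc j) * pi"
    by (rule one_over_lessD) auto
  then have 1: "real k + 1/2 < real (Suc j)"
    by simp
  have "1 / ((real k + 3/2) * pi) < 1 / (real (Suc j) * pi)"
    using assms(3) by (simp add: j ring_height_def)
  then have "real (Suc j) * pi < (real k + 3/2) * pi"
    by (rule one_over_lessD) auto
  then have 2: "real (Suc j) < real k + 3/2"
    by simp
  have "j = k" using 1 2 by linarith
  then show ?thesis by (simp add: j)
qed

text \<open>Covers both flows of the theorem: \<open>r\<close> is constantly 1 for the fast one and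
  \<open>1 - z\<close> for the slow one. Positivity is demanded only below the north pole, where the
  slow rate vanishes.\<close>

locale spiral_flow =
  fixes \<phi> :: "real^3 \<Rightarrow> real \<Rightarrow> real^3" and r :: "real \<Rightarrow> real" and K :: real
  assumes is_flow: "is_flow_S2 \<phi>"
    and deriv: "x \<in> S2 \<Longrightarrow> (\<phi> x has_vector_derivative r (\<phi> x t $ 3) *\<^sub>R spiral (\<phi> x t)) (at t)"
    and lipschitz: "x \<in> S2 \<Longrightarrow> y \<in> S2 \<Longrightarrow>
      norm (r (x$3) *\<^sub>R spiral x - r (y$3) *\<^sub>R spiral y) \<le> K * norm (x - y)"
    and rate_pos: "z < 1 \<Longrightarrow> r z > 0"
begin

lemma in_S2: "x \<in> S2 \<Longrightarrow> \<phi> x t \<in> S2"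
  and at_0: "x \<in> S2 \<Longrightarrow> \<phi> x 0 = x"
  and flow_add: "x \<in> S2 \<Longrightarrow> \<phi> (\<phi> x s) t = \<phi> x (s + t)"
  using is_flow by (auto simp: is_flow_S2_def)

text \<open>On a critical level the field is a pure rotation with constant speed, so the rotation
  solves the equation, and Gronwall's inequality identifies it with the flow.\<close>

lemma flow_critical:
  assumes x: "x \<in> S2" "critical (x$3)"
  shows "\<phi> x t = zrot (r (x$3) * t) x"
proof -
  define c where "c = r (x$3)"
  have rot: "((\<lambda>t. zrot (c * t) x) has_vector_derivative
      r (zrot (c * t) x $ 3) *\<^sub>R spiral (zrot (c * t) x)) (at t)" for t
    using zrot_has_vector_derivative[of c x t] spiral_critical[OF zrot_in_S2[OF x(1)]] x(2)
    by (simp add: c_def)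
  have "norm (\<phi> x t - zrot (c * t) x) \<le> exp (K * \<bar>t\<bar>) * norm (\<phi> x 0 - zrot (c * 0) x)"
    by (rule gronwall_difference[OF deriv[OF x(1)] rot lipschitz[OF in_S2[OF x(1)] zrot_in_S2[OF x(1)]]])
  moreover have "zrot (c * 0) x = x"
    by (simp add: vec_eq_iff forall_3)
  ultimately show ?thesis
    by (simp add: at_0 x c_def)
qed

text \<open>Running time backwards from the meeting moment, \<open>flow_critical\<close> keeps the
  height fixed. Critical levels are thus barriers that no other orbit can reach.\<close>

lemma height_const_if_meets_critical:
  assumes x: "x \<in> S2" and "critical (\<phi> x t $ 3)"
  shows "\<phi> x t $ 3 = x$3"
proof -
  have "x = \<phi> (\<phi> x t) (- t)"
    by (simp add: flow_add x at_0)
  also have "\<dots> $ 3 = \<phi> x t $ 3"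
    by (subst flow_critical) (simp_all add: in_S2 assms)
  finally show ?thesis by simp
qed

lemma height_deriv:
  assumes "x \<in> S2"
  shows "((\<lambda>t. \<phi> x t $ 3) has_real_derivative
    r (\<phi> x t $ 3) * (flat_osc (1 - \<phi> x t $ 3) * ((\<phi> x t $ 1)\<^sup>2 + (\<phi> x t $ 2)\<^sup>2))) (at t)"
  using bounded_linear.has_vector_derivative[OF bounded_linear_vec_nth deriv[OF assms], of 3 t]
  by (simp add: has_real_derivative_iff_has_vector_derivative)

lemma height_continuous_on: "x \<in> S2 \<Longrightarrow> continuous_on T (\<lambda>t. \<phi> x t $ 3)"
  by (intro continuous_at_imp_continuous_on ballI DERIV_isCont[OF height_deriv])

text \<open>By Rolle's theorem the height of a periodic orbit has a critical time, and the orbit is then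
  confined to the height it has at that time.\<close>

lemma periodic_point_imp_critical:
  assumes x: "x \<in> S2" and "periodic_point \<phi> x"
  shows "critical (x$3)"
proof -
  obtain s where s: "s > 0" "\<phi> x s = x"
    using assms by (auto simp: periodic_point_def)
  have "\<exists>t>0. t < s \<and> ((\<lambda>t. \<phi> x t $ 3) has_real_derivative 0) (at t)"
  proof (rule Rolle)
    show "\<phi> x 0 $ 3 = \<phi> x s $ 3"
      by (simp add: s at_0 x)
    show "continuous_on {0..s} (\<lambda>t. \<phi> x t $ 3)"
      by (rule height_continuous_on[OF x])
    show "(\<lambda>t. \<phi> x t $ 3) differentiable (at t)" for t
      using height_deriv[OF x] real_differentiable_def by blast
  qed (rule s)
  then obtain t where "((\<lambda>t. \<phi> x t $ 3) has_real_derivative 0) (at t)"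
    by blast
  then have "r (\<phi> x t $ 3) * (flat_osc (1 - \<phi> x t $ 3) * ((\<phi> x t $ 1)\<^sup>2 + (\<phi> x t $ 2)\<^sup>2)) = 0"
    using height_deriv[OF x] DERIV_unique by blast
  \<comment> \<open>The rate can vanish only at height 1, which is itself critical; elsewhere one of
    the other factors must be zero.\<close>
  moreover have "r (\<phi> x t $ 3) \<noteq> 0" if "\<phi> x t $ 3 \<noteq> 1"
    using that rate_pos[of "\<phi> x t $ 3"] abs_height_le_1[OF in_S2[OF x], of t] by fastforce
  ultimately have "critical (\<phi> x t $ 3)"
    using critical_iff[OF in_S2[OF x], of t] by (auto simp: critical_def)
  then show ?thesis
    using height_const_if_meets_critical[OF x] by metis
qed

lemma orb_critical:
  assumes x: "x \<in> S2" "critical (x$3)"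
  shows "orb \<phi> x = level (x$3)"
proof
  show "orb \<phi> x \<subseteq> level (x$3)"
    using zrot_in_S2[OF x(1)] by (auto simp: orb_def level_def flow_critical x)
  show "level (x$3) \<subseteq> orb \<phi> x"
  proof
    fix y assume "y \<in> level (x$3)"
    then obtain a where a: "y = zrot a x"
      using same_height_imp_zrot[OF x(1), of y] by (auto simp: level_def)
    show "y \<in> orb \<phi> x"
    \<comment> \<open>At the north pole the rate may be 0, but there the level is a single point.
      Below it every angle \<open>a\<close> is reached at time \<open>a / r\<close>.\<close>
    proof (cases "x$3 = 1")
      case True
      then have "y = \<phi> x 0"
        using zrot_north_pole[OF x(1)] by (simp add: a at_0 x)
      then show ?thesis by (simp add: orb_def)
    next
      case False
      then have "r (x$3) > 0"
        using abs_height_le_1[OF x(1)] by (intro rate_pos) auto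
      then have "y = \<phi> x (a / r (x$3))"
        by (simp add: flow_critical x a)
      then show ?thesis by (simp add: orb_def)
    qed
  qed
qed

lemma isolated_orbit_level: "isolated_orbit \<phi> (level (ring_height k))"
proof -
  \<comment> \<open>The ring of index \<open>k\<close> corresponds to \<open>(k + 1) pi\<close>; the
    walls are placed half a step to either side.\<close>
  define a b where "a = 1 - 1 / ((real k + 1/2) * pi)" and "b = 1 - 1 / ((real k + 3/2) * pi)"
  define U where "U = {x :: real^3. a < x$3 \<and> x$3 < b}"
  have "open U"
    unfolding U_def by (intro open_Collect_conj open_Collect_less continuous_intros)
  moreover have "1 / (real (Suc k) * pi) < 1 / ((real k + 1/2) * pi)"
      "1 / ((real k + 3/2) * pi) < 1 / (real (Suc k) * pi)"
    by (intro divide_strict_left_mono mult_strict_right_mono mult_pos_pos; simp)+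
  then have "level (ring_height k) \<subseteq> U"
    by (auto simp: level_def U_def a_def b_def ring_height_def)
  moreover have "O' = level (ring_height k)" if "O' \<in> periodic_orbits \<phi>" "O' \<subseteq> U" for O'
  proof -
    obtain x where x: "x \<in> S2" "periodic_point \<phi> x" "O' = orb \<phi> x"
      using \<open>O' \<in> periodic_orbits \<phi>\<close> by (auto simp: periodic_orbits_def)
    then have crit: "critical (x$3)"
      using periodic_point_imp_critical by blast
    then have eq: "O' = level (x$3)"
      using x orb_critical by blast
    then have "x \<in> U"
      using \<open>O' \<subseteq> U\<close> x(1) by (auto simp: level_def)
    then have "x$3 = ring_height k"
      using crit by (intro ring_height_separated) (auto simp: U_def a_def b_def)
    then show ?thesis by (simp add: eq)
  qed
  ultimately show ?thesis
    unfolding isolated_orbit_def by blast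
qed

text \<open>The ring turns with angular speed \<open>r (ring_height k)\<close>, so a full turn takes
  \<open>2 pi\<close> divided by that speed, and the hypothesis says that this is at most
  \<open>t\<close>.\<close>

lemma level_in_P:
  assumes "r (ring_height k) * t \<ge> 2 * pi"
  shows "level (ring_height k) \<in> P \<phi> t"
proof -
  obtain x where x: "x \<in> S2" "x$3 = ring_height k"
    using level_ring_height_nonempty by (auto simp: level_def)
  have crit: "critical (x$3)"
    by (simp add: critical_def x)
  have "r (ring_height k) > 0"
    by (intro rate_pos ring_height_bounds)
  then have "0 < 2 * pi / r (ring_height k)" "2 * pi / r (ring_height k) \<le> t"
      "\<phi> x (2 * pi / r (ring_height k)) = x"
    using assms flow_critical[OF x(1) crit]
    by (simp_all add: x zrot_2pi pos_divide_le_eq mult.commute[of t])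
  moreover have "orb \<phi> x = level (ring_height k)"
    using orb_critical[OF x(1) crit] by (simp add: x)
  ultimately show ?thesis
    using isolated_orbit_level[of k] x(1) unfolding P_def by (auto intro!: exI[of _ x])
qed

text \<open>Away from the poles a point returns only after its angle has run through a positive
  multiple of \<open>2 pi\<close>, which bounds every return time from below by one full
  turn.\<close>

lemma P_subset:
  "P \<phi> t \<subseteq> level ` ({1, -1} \<union> ring_height ` {k. r (ring_height k) * t \<ge> 2 * pi})"
proof
  fix A assume "A \<in> P \<phi> t"
  then obtain x s where x: "x \<in> S2" "A = orb \<phi> x" and s: "0 < s" "s \<le> t" "\<phi> x s = x"
    by (auto simp: P_def)
  have crit: "critical (x$3)"
    using x(1) s by (intro periodic_point_imp_critical) (auto simp: periodic_point_def)
  have A: "A = level (x$3)"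
    using orb_critical[OF x(1) crit] x(2) by simp
  have "x$3 \<in> {1, -1} \<union> ring_height ` {k. r (ring_height k) * t \<ge> 2 * pi}"
  proof (cases "x$3 = 1 \<or> x$3 = -1")
    case False
    then obtain k where k: "x$3 = ring_height k"
      using crit by (auto simp: critical_def)
    define a where "a = r (ring_height k) * s"
    have r: "r (ring_height k) > 0"
      by (intro rate_pos ring_height_bounds)
    have rot: "zrot a x = x"
      using flow_critical[OF x(1) crit, of s] s by (simp add: k a_def)
    \<comment> \<open>The inner product of the horizontal part with its rotated copy isolates
      \<open>cos a\<close>; dividing by the nonzero squared radius gives
      \<open>cos a = 1\<close>.\<close>
    have "cos a * ((x$1)\<^sup>2 + (x$2)\<^sup>2) = zrot a x $ 1 * x$1 + zrot a x $ 2 * x$2"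
      by (simp add: power2_eq_square algebra_simps)
    also have "\<dots> = 1 * ((x$1)\<^sup>2 + (x$2)\<^sup>2)"
      by (simp only: rot power2_eq_square mult_1)
    finally have "cos a = 1"
      using pole_iff[OF x(1)] False mult_right_cancel by blast
    moreover have "a > 0"
      using r s by (simp add: a_def)
    moreover have "- (real n * 2 * pi) \<le> 0" for n
      by simp
    ultimately obtain n :: nat where n: "a = real n * 2 * pi"
      unfolding cos_one_2pi by (metis not_less)
    with \<open>a > 0\<close> have "n \<ge> 1"
      by (cases n) auto
    then have "1 * (2 * pi) \<le> real n * (2 * pi)"
      by (intro mult_right_mono) auto
    also have "\<dots> = a" by (simp add: n)
    also have "\<dots> \<le> r (ring_height k) * t"
      using r s by (simp add: a_def)
    finally show ?thesis using k by auto
  qed auto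
  then show "A \<in> level ` ({1, -1} \<union> ring_height ` {k. r (ring_height k) * t \<ge> 2 * pi})"
    using A by blast
qed

text \<open>Some ring lies above the starting height, and by the intermediate value theorem the
  orbit would have to meet it before rising higher. This keeps the slow rate \<open>1 - z\<close>
  bounded below along each orbit.\<close>

lemma height_bounded_away_from_1:
  assumes x: "x \<in> S2" "x$3 < 1"
  obtains c where "c > 0" "\<And>t. \<phi> x t $ 3 \<le> 1 - c"
proof -
  obtain k :: nat where "inverse (real (Suc k)) < 1 - x$3"
    using reals_Archimedean[of "1 - x$3"] x by auto
  moreover have "1 / (real (Suc k) * pi) \<le> inverse (real (Suc k))"
    using pi_gt3 by (simp add: divide_simps)
  ultimately have k: "x$3 < ring_height k"
    by (simp add: ring_height_def)
  have "\<phi> x t $ 3 \<le> ring_height k" for t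
  proof (rule ccontr)
    assume "\<not> \<phi> x t $ 3 \<le> ring_height k"
    then have "\<exists>s. \<phi> x s $ 3 = ring_height k"
    proof -
      have conn: "connected (range (\<lambda>t. \<phi> x t $ 3))"
        by (intro connected_continuous_image height_continuous_on[OF x(1)] connected_UNIV)
      have "x$3 \<in> range (\<lambda>t. \<phi> x t $ 3)"
        using at_0[OF x(1)] by (metis rangeI)
      from connectedD_interval[OF conn this rangeI[of _ t], of "ring_height k"]
      show ?thesis
        using k \<open>\<not> \<phi> x t $ 3 \<le> ring_height k\<close> by (auto simp: image_iff)
    qed
    then obtain s where s: "\<phi> x s $ 3 = ring_height k" ..
    then have "\<phi> x s $ 3 = x$3"
      by (intro height_const_if_meets_critical x) (simp add: critical_def)
    then show False using s k by simp
  qed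
  then show thesis
    using that[of "1 - ring_height k"] ring_height_bounds[of k] by simp
qed

end

section \<open>Existence and equivalence of the two flows\<close>

lemma spiral_flow_exists:
  assumes r: "\<And>k. Ck k (\<lambda>x::real^3. r (x$3)) UNIV" and pos: "\<And>z. z < 1 \<Longrightarrow> r z > 0"
  shows "\<exists>\<phi> K. spiral_flow \<phi> r K \<and> smooth_flow_S2 \<phi>"
proof -
  define V :: "real^3 \<Rightarrow> real^3" where "V x = r (x$3) *\<^sub>R spiral x" for x
  have smooth: "Ck k V UNIV" for k
    unfolding V_def by (intro Ck_scaleR r Ck_spiral)
  have tangent: "V x \<bullet> x = 0" for x
    by (simp add: V_def spiral_tangent)
  obtain \<phi> where \<phi>: "is_flow_S2 \<phi>" "\<And>x t. x \<in> S2 \<Longrightarrow> (\<phi> x has_vector_derivative V (\<phi> x t)) (at t)"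
    using tangent_field_has_flow_S2[OF smooth tangent] by blast
  obtain K where "\<And>x y. x \<in> cball 0 1 \<Longrightarrow> y \<in> cball 0 1 \<Longrightarrow> norm (V x - V y) \<le> K * norm (x - y)"
    by (rule Ck1_imp_lipschitz_on_compact_convex[OF smooth, of "cball 0 1"]) auto
  then have "spiral_flow \<phi> r K"
    using \<phi> pos by unfold_locales (auto simp: V_def S2_def)
  moreover have "smooth_vector_field_S2 V"
    unfolding smooth_vector_field_S2_def smooth_on_def using smooth tangent by blast
  then have "smooth_flow_S2 \<phi>"
    unfolding smooth_flow_S2_def using \<phi> by blast
  ultimately show ?thesis by blast
qed

lemma continuous_unbounded_surj:
  fixes f :: "real \<Rightarrow> real"
  assumes "continuous_on UNIV f" "c > 0" "\<And>t. t \<ge> 0 \<Longrightarrow> c * t \<le> f t" "\<And>t. t \<le> 0 \<Longrightarrow> f t \<le> c * t"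
  shows "surj f"
proof -
  have conn: "connected (range f)"
    by (intro connected_continuous_image assms(1) connected_UNIV)
  have "y \<in> range f" for y
  proof (rule connectedD_interval[OF conn rangeI rangeI])
    show "f (- \<bar>y\<bar> / c) \<le> y" "y \<le> f (\<bar>y\<bar> / c)"
      using assms(2) assms(3)[of "\<bar>y\<bar> / c"] assms(4)[of "- \<bar>y\<bar> / c"] by auto
  qed
  then show ?thesis by blast
qed

text \<open>Let \<open>\<tau>\<close> be the integral of \<open>h = 1 - z\<close> along the slow
  orbit. Then \<open>\<phi> x\<close> and \<open>\<psi> x\<close> after \<open>\<tau>\<close> both
  solve \<open>u' = h t * spiral u\<close> with the same start, so they agree. The lower bound
  \<open>c\<close> on \<open>h\<close> makes \<open>\<tau>\<close> onto, hence the whole orbit is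
  covered.\<close>

lemma spiral_flow_time_change:
  assumes \<psi>: "spiral_flow \<psi> (\<lambda>_. 1) L" and \<phi>: "spiral_flow \<phi> (\<lambda>z. 1 - z) K" and x: "x \<in> S2"
  obtains \<tau> :: "real \<Rightarrow> real"
  where "strict_mono \<tau>" "surj \<tau>" "\<tau> 0 = 0" "\<And>t. \<phi> x t = \<psi> x (\<tau> t)"
proof (cases "x$3 = 1")
  case True
  then have "critical (x$3)"
    by (simp add: critical_def)
  \<comment> \<open>Here \<open>h\<close> would be identically 0, but both flows fix the north pole,
    so the identity serves as time change.\<close>
  then have "\<phi> x t = \<psi> x (id t)" for t
    using spiral_flow.flow_critical[OF \<psi> x] spiral_flow.flow_critical[OF \<phi> x]
    by (simp only: zrot_north_pole[OF x True])
  then show thesis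
    by (intro that[of id]) (auto simp: strict_mono_def)
next
  case False
  interpret \<psi>: spiral_flow \<psi> "\<lambda>_. 1" L by (rule \<psi>)
  interpret \<phi>: spiral_flow \<phi> "\<lambda>z. 1 - z" K by (rule \<phi>)
  define h where "h t = 1 - \<phi> x t $ 3" for t
  define \<tau> where "\<tau> t = (LBINT s=0..t. h s)" for t :: real
  have "x$3 < 1"
    using False abs_height_le_1[OF x] by linarith
  then obtain c where c: "c > 0" "\<And>t. \<phi> x t $ 3 \<le> 1 - c"
    using \<phi>.height_bounded_away_from_1[OF x] by blast
  have h_ge: "c \<le> h t" and h_le: "h t \<le> 2" for t
    using c(2)[of t] abs_height_le_1[OF \<phi>.in_S2[OF x], of t] by (auto simp: h_def)
  have "continuous_on UNIV h"
    unfolding h_def by (intro continuous_intros \<phi>.height_continuous_on x)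
  then have \<tau>': "(\<tau> has_real_derivative h t) (at t)" for t
    unfolding \<tau>_def has_real_derivative_iff_has_vector_derivative
    by (rule interval_integral_has_vector_derivative)
  have \<tau>0: "\<tau> 0 = 0"
    by (simp add: \<tau>_def zero_ereal_def)
  have mono: "strict_mono \<tau>"
  proof (rule strict_monoI)
    fix a b :: real assume "a < b"
    moreover have "h t > 0" for t
      using h_ge[of t] c(1) by linarith
    ultimately show "\<tau> a < \<tau> b"
      using DERIV_pos_imp_increasing[of a b \<tau>] \<tau>' by blast
  qed
  have lower: "\<tau> a - c * a \<le> \<tau> b - c * b" if "a \<le> b" for a b
  proof (rule DERIV_nonneg_imp_nondecreasing[OF that])
    fix t
    have "((\<lambda>t. \<tau> t - c * t) has_real_derivative h t - c) (at t)"
      by (auto intro!: derivative_eq_intros \<tau>')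
    then show "\<exists>y. ((\<lambda>t. \<tau> t - c * t) has_real_derivative y) (at t) \<and> 0 \<le> y"
      using h_ge[of t] by (intro exI[of _ "h t - c"]) simp
  qed
  have "surj \<tau>"
  proof (rule continuous_unbounded_surj[OF _ c(1)])
    show "continuous_on UNIV \<tau>"
      by (intro continuous_at_imp_continuous_on ballI DERIV_isCont[OF \<tau>'])
    show "c * t \<le> \<tau> t" if "t \<ge> 0" for t
      using lower[OF that] by (simp add: \<tau>0)
    show "\<tau> t \<le> c * t" if "t \<le> 0" for t
      using lower[OF that] by (simp add: \<tau>0)
  qed
  have "((\<lambda>t. \<psi> x (\<tau> t)) has_vector_derivative h t *\<^sub>R spiral (\<psi> x (\<tau> t))) (at t)" for t
    using vector_diff_chain_at[OF \<tau>'[unfolded has_real_derivative_iff_has_vector_derivative] \<psi>.deriv[OF x]]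
    by (simp add: o_def)
  moreover have "(\<phi> x has_vector_derivative h t *\<^sub>R spiral (\<phi> x t)) (at t)" for t
    using \<phi>.deriv[OF x] by (simp add: h_def)
  \<comment> \<open>The factor 2 bounds \<open>h\<close>, because heights on the sphere are at least
    -1.\<close>
  moreover have "norm (h t *\<^sub>R spiral (\<phi> x t) - h t *\<^sub>R spiral (\<psi> x (\<tau> t)))
      \<le> 2 * L * norm (\<phi> x t - \<psi> x (\<tau> t))" for t
  proof -
    have "norm (h t *\<^sub>R spiral (\<phi> x t) - h t *\<^sub>R spiral (\<psi> x (\<tau> t)))
        = h t * norm (spiral (\<phi> x t) - spiral (\<psi> x (\<tau> t)))"
      using h_ge[of t] c(1) by (simp add: scaleR_diff_right[symmetric])
    also have "\<dots> \<le> 2 * (L * norm (\<phi> x t - \<psi> x (\<tau> t)))"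
      using h_ge[of t] h_le[of t] c(1) \<psi>.lipschitz[OF \<phi>.in_S2[OF x] \<psi>.in_S2[OF x], of t "\<tau> t"]
      by (intro mult_mono) auto
    finally show ?thesis by simp
  qed
  ultimately have "norm (\<phi> x t - \<psi> x (\<tau> t)) \<le> exp (2 * L * \<bar>t\<bar>) * norm (\<phi> x 0 - \<psi> x (\<tau> 0))" for t
    by (intro gronwall_difference)
  then have "\<phi> x t = \<psi> x (\<tau> t)" for t
    by (simp add: \<tau>0 \<phi>.at_0 \<psi>.at_0 x)
  with mono \<open>surj \<tau>\<close> \<tau>0 show thesis
    by (intro that)
qed

text \<open>The identity serves as the homeomorphism: an increasing surjective time change leaves
  orbits and their orientation unchanged.\<close>

lemma spiral_flows_equivalent:
  assumes \<psi>: "spiral_flow \<psi> (\<lambda>_. 1) L" and \<phi>: "spiral_flow \<phi> (\<lambda>z. 1 - z) K"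
  shows "flows_equivalent \<phi> \<psi>"
  unfolding flows_equivalent_def
proof (rule exI, rule exI, intro conjI ballI)
  show "homeomorphism S2 S2 (\<lambda>x. x) (\<lambda>x. x)"
    by (rule homeomorphism_ident)
  fix x assume x: "x \<in> S2"
  obtain \<tau> :: "real \<Rightarrow> real" where \<tau>: "strict_mono \<tau>" "surj \<tau>" "\<tau> 0 = 0" "\<And>t. \<phi> x t = \<psi> x (\<tau> t)"
    using spiral_flow_time_change[OF \<psi> \<phi> x] by blast
  have "\<phi> x = \<psi> x \<circ> \<tau>"
    using \<tau>(4) by auto
  then show "orb \<phi> x = (\<lambda>x. x) ` orb \<psi> x"
    unfolding orb_def image_ident by (simp only: image_comp[symmetric] \<tau>(2))
  show "\<exists>\<tau>. strict_mono \<tau> \<and> \<tau> 0 = 0 \<and> (\<forall>t. \<phi> x t = \<psi> x (\<tau> t))"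
    using \<tau> by blast
qed

subsection \<open>Counting closed orbits\<close>

lemma inj_level_ring_height: "inj (\<lambda>k. level (ring_height k))"
proof (rule injI)
  fix j k assume "level (ring_height j) = level (ring_height k)"
  then have "ring_height j = ring_height k"
    using level_ring_height_nonempty[of j] by (auto simp: level_def)
  then show "j = k"
    using inj_ring_height by (simp add: inj_eq)
qed

text \<open>All rings have the common period \<open>2 pi\<close>, so from that time on infinitely
  many orbits are counted.\<close>

lemma EP_unit_rate:
  assumes "spiral_flow \<psi> (\<lambda>_. 1) L"
  shows "EP \<psi> = \<infinity>"
proof -
  interpret spiral_flow \<psi> "\<lambda>_. 1" L by (rule assms)
  have "growth_term \<psi> t = \<infinity>" if "t \<ge> 2 * pi" for t
  proof -
    have "range (\<lambda>k. level (ring_height k)) \<subseteq> P \<psi> t"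
      using level_in_P that by auto
    then have "infinite (P \<psi> t)"
      using range_inj_infinite[OF inj_level_ring_height] infinite_super by blast
    then show ?thesis by (simp add: growth_term_def)
  qed
  then have "eventually (\<lambda>t. growth_term \<psi> t = \<infinity>) at_top"
    using eventually_at_top_linorder by blast
  then have "(growth_term \<psi> \<longlongrightarrow> \<infinity>) at_top"
    by (rule tendsto_eventually)
  then show ?thesis
    unfolding EP_def by (intro lim_imp_Limsup) auto
qed

text \<open>The ring of index \<open>k\<close> has period \<open>2 pi\<^sup>2 (k + 1)\<close>, so at
  most \<open>2 + t\<close> orbits are counted, and the logarithm of this divided by
  \<open>t\<close> tends to 0.\<close>

lemma EP_vanishing_rate:
  assumes "spiral_flow \<phi> (\<lambda>z. 1 - z) K"
  shows "EP \<phi> = 0"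
proof -
  interpret spiral_flow \<phi> "\<lambda>z. 1 - z" K by (rule assms)
  have pi2: "2 * pi * pi \<ge> 2"
    using mult_mono[of 1 pi 1 pi] pi_gt3 by simp
  have bounds: "0 \<le> growth_term \<phi> t \<and> growth_term \<phi> t \<le> ereal (2 * (ln t / t))"
    if t: "t \<ge> 2 * pi * pi" for t
  proof -
    have t2: "t \<ge> 2" using t pi2 by linarith
    have "k \<in> {..<nat \<lfloor>t\<rfloor>}" if "(1 - ring_height k) * t \<ge> 2 * pi" for k
    proof -
      have "2 * pi \<le> t / (real (Suc k) * pi)"
        using that by (simp add: one_minus_ring_height)
      then have "2 * pi * (real (Suc k) * pi) \<le> t"
        by (subst (asm) pos_le_divide_eq) auto
      then have "real (Suc k) * (2 * pi * pi) \<le> t"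
        by (simp only: ac_simps)
      moreover have "real (Suc k) * 1 \<le> real (Suc k) * (2 * pi * pi)"
        using pi2 by (intro mult_left_mono) auto
      ultimately have "real (Suc k) \<le> t" by (metis mult.right_neutral order_trans)
      then have "int (Suc k) \<le> \<lfloor>t\<rfloor>" by (simp add: le_floor_iff)
      then show ?thesis by simp
    qed
    then have "{k. (1 - ring_height k) * t \<ge> 2 * pi} \<subseteq> {..<nat \<lfloor>t\<rfloor>}"
      by blast
    then have sub: "P \<phi> t \<subseteq> level ` ({1, -1} \<union> ring_height ` {..<nat \<lfloor>t\<rfloor>})"
      using P_subset[of t] by blast
    then have fin: "finite (P \<phi> t)"
      by (rule finite_subset) auto
    have "card (P \<phi> t) \<le> card ({1, -1} \<union> ring_height ` {..<nat \<lfloor>t\<rfloor>})"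
      by (rule order_trans[OF card_mono[OF _ sub] card_image_le]) auto
    \<comment> \<open>Two poles, and fewer than \<open>t + 1\<close> rings because each period is at
      least the ring number \<open>k + 1\<close>.\<close>
    also have "\<dots> \<le> card {1, -1 :: real} + card {..<nat \<lfloor>t\<rfloor>}"
      by (rule order_trans[OF card_Un_le add_left_mono[OF card_image_le]]) auto
    also have "\<dots> \<le> 2 + nat \<lfloor>t\<rfloor>"
      by simp
    finally have "real (card (P \<phi> t)) \<le> 2 + t"
      using t2 by linarith
    also have "\<dots> \<le> t\<^sup>2"
    proof -
      have "2 * t \<le> t * t"
        using t2 by (intro mult_right_mono) auto
      then show ?thesis
        using t2 unfolding power2_eq_square by linarith
    qed
    finally have card_le: "real (card (P \<phi> t)) \<le> t\<^sup>2" .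
    \<comment> \<open>The lowest ring has period \<open>2 pi\<^sup>2\<close>, which explains the
      threshold on \<open>t\<close>. Its presence keeps \<open>growth_term\<close> from taking the
      value for an empty set, minus infinity.\<close>
    have "level (ring_height 0) \<in> P \<phi> t"
      using t by (intro level_in_P) (simp add: one_minus_ring_height field_simps)
    then have card_pos: "card (P \<phi> t) > 0"
      using fin card_gt_0_iff by blast
    have "ln (real (card (P \<phi> t))) \<le> ln (t\<^sup>2)"
      using card_pos card_le by (intro ln_mono) auto
    also have "\<dots> = 2 * ln t"
      using t2 by (simp add: ln_realpow)
    finally have "ln (real (card (P \<phi> t))) / t \<le> 2 * (ln t / t)"
      using t2 by (simp add: divide_right_mono)
    moreover have "0 \<le> ln (real (card (P \<phi> t))) / t"
      using card_pos t2 by (intro divide_nonneg_nonneg ln_ge_zero) auto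
    ultimately show ?thesis
      using fin card_pos by (auto simp: growth_term_def card_gt_0_iff)
  qed
  have "((\<lambda>t::real. 2 * (ln t / t)) \<longlongrightarrow> 2 * 0) at_top"
    by (intro tendsto_intros ln_x_over_x_tendsto_0)
  then have upper: "((\<lambda>t. ereal (2 * (ln t / t))) \<longlongrightarrow> 0) at_top"
    by (simp add: zero_ereal_def)
  have "(growth_term \<phi> \<longlongrightarrow> 0) at_top"
    by (rule tendsto_sandwich[OF _ _ tendsto_const upper];
        rule eventually_mono[OF eventually_ge_at_top[of "2 * pi * pi"]], use bounds in blast)
  then show ?thesis
    unfolding EP_def by (intro lim_imp_Limsup) auto
qed

theorem theorem1:
  shows "\<exists>\<phi> \<psi>. smooth_flow_S2 \<phi> \<and> smooth_flow_S2 \<psi> \<and> flows_equivalent \<phi> \<psi>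
           \<and> EP \<phi> = 0 \<and> EP \<psi> = \<infinity>"
proof -
  obtain \<psi> L where \<psi>: "spiral_flow \<psi> (\<lambda>_. 1) L" "smooth_flow_S2 \<psi>"
    using spiral_flow_exists[of "\<lambda>_. 1", OF Ck_const] by auto
  have "Ck k (\<lambda>x::real^3. 1 - x$3) UNIV" for k
    by (intro Ck_diff Ck_const Ck_nth)
  then obtain \<phi> K where \<phi>: "spiral_flow \<phi> (\<lambda>z. 1 - z) K" "smooth_flow_S2 \<phi>"
    using spiral_flow_exists[of "\<lambda>z. 1 - z"] by fastforce
  show ?thesis
    using \<psi> \<phi> spiral_flows_equivalent EP_unit_rate EP_vanishing_rate by blast
qed

end
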